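(* Let $0 \le a < b < \infty$, let $f : \mathbb{R} \times \mathbb{R} \to \mathbb{R}$ be continuous, let $g(\tau) = \sum_{i=0}^n \alpha_i \tau^i$ (with $n \ge 0$, $\alpha_n \neq 0$) be a polynomial weight function on $[a,b]$, and let $\phi : [-b,0] \to \mathbb{R}$ be a continuous history function. Consider the delay differential equation with distributed delay $$ \text{(D)} \qquad y'(t) = f\Big( y(t), \int_a^b y(t-\tau)\, g(\tau) \, \mathrm{d}\tau \Big) $$ and the system with discrete delays $$ \text{(E)} \qquad \begin{aligned} y'(t) &= f\Big( y(t), \sum_{i=0}^n \alpha_i x_i(t) \Big), \\ x_0'(t) &= y(t-a) - y(t-b), \\ x_i'(t) &= y(t-a)\, a^i - y(t-b)\, b^i + i\, x_{i-1}(t) \quad \text{for } i = 1, \ldots, n. \end{aligned} $$ Then the following hold. (1) If $y$ is a solution of the initial value problem of (D) with history $\phi$, then $y$ together with the functions $x_i(t) = \int_a^b y(t-\tau)\, \tau^i \, \mathrm{d}\tau$ for $i=0,\ldots,n$ and $t \ge 0$ satisfies the system (E) for all $t > 0$. (2) Conversely, if $(y, x_0, \ldots, x_n)$ is a solution of the initial value problem of (E) with initial values $y(t) = \phi(t)$ for $t \in [-b,0]$ and $x_i(0) = \int_a^b \phi(-\tau)\, \tau^i \, \mathrm{d}\tau$ for $i = 0, \ldots, n$, then $y$ is a solution of the initial value problem of (D) with history $\phi$.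
   Context: Weight function: $g : [a,b] \to \mathbb{R}$ has the properties of a probability density, i.e. it is measurable, $g(\tau) \ge 0$ for all $\tau \in [a,b]$, and $\int_a^b g(\tau)\,\mathrm{d}\tau = 1$. Solution of an initial value problem of (D): a continuous function $y : [-b,\infty) \to \mathbb{R}$ such that (i) $y$ is continuously differentiable on $(0,\infty)$ and $\lim_{t \to 0+} y'(t)$ exists, (ii) $y$ satisfies (D) for all $t > 0$, (iii) $y(t) = \phi(t)$ for $t \in [-b,0]$. Solution of an initial value problem of (E): $y : [-b,\infty) \to \mathbb{R}$ and $x_0, \ldots, x_n : [0,\infty) \to \mathbb{R}$ are continuous, are continuously differentiable on $(0,\infty)$ with right-sided limits of the derivatives existing at $0$, satisfy (E) for all $t > 0$, and attain the prescribed initial values (for the variables $x_i$, initial values are required only at $t = 0$). Convention: $\tau^0 = 1$ for all $\tau$, including $\tau = 0$. Uniqueness of solutions of initial value problems of (D) is not assumed. *)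

theory Defs
  imports "HOL-Analysis.Analysis"
begin

text \<open>
  Functions on subsets of the real line are total functions of which only the values on the
  intended domain matter: \<open>y\<close> on \<open>{-b..}\<close>, each \<open>x i\<close> on \<open>{0..}\<close>, \<open>g\<close> on \<open>{a..b}\<close>,
  \<open>\<phi>\<close> on \<open>{-b..0}\<close>. All derivatives are taken at points \<open>t > 0\<close>, which are interior to the
  domains of \<open>y\<close> and \<open>x i\<close>.

  The Henstock-Kurzweil integral \<^const>\<open>integral\<close> coincides with the Lebesgue integral for all
  integrands below: \<open>g\<close> is nonnegative, hence absolutely integrable once it is integrable, and
  it is only multiplied by continuous functions on \<open>{a..b}\<close>.
\<close>

definition weight_function :: "real \<Rightarrow> real \<Rightarrow> (real \<Rightarrow> real) \<Rightarrow> bool" where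
  "weight_function a b g \<longleftrightarrow>
     g \<in> borel_measurable (lebesgue_on {a..b}) \<and>
     (\<forall>\<tau>\<in>{a..b}. 0 \<le> g \<tau>) \<and>
     (g has_integral 1) {a..b}"

definition C1_right_of_zero :: "(real \<Rightarrow> real) \<Rightarrow> bool" where
  "C1_right_of_zero y \<longleftrightarrow>
     y C1_differentiable_on {0<..} \<and> (\<exists>L. (deriv y \<longlongrightarrow> L) (at_right 0))"

definition distributed_eq ::
  "real \<Rightarrow> real \<Rightarrow> (real \<times> real \<Rightarrow> real) \<Rightarrow> (real \<Rightarrow> real) \<Rightarrow> (real \<Rightarrow> real) \<Rightarrow> real \<Rightarrow> bool" where
  "distributed_eq a b f g y t \<longleftrightarrow>
     (y has_real_derivative f (y t, integral {a..b} (\<lambda>\<tau>. y (t - \<tau>) * g \<tau>))) (at t)"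

definition distributed_solution ::
  "real \<Rightarrow> real \<Rightarrow> (real \<times> real \<Rightarrow> real) \<Rightarrow> (real \<Rightarrow> real) \<Rightarrow> (real \<Rightarrow> real) \<Rightarrow> (real \<Rightarrow> real) \<Rightarrow> bool" where
  "distributed_solution a b f g \<phi> y \<longleftrightarrow>
     continuous_on {-b..} y \<and>
     C1_right_of_zero y \<and>
     (\<forall>t>0. distributed_eq a b f g y t) \<and>
     (\<forall>t\<in>{-b..0}. y t = \<phi> t)"

definition discrete_system ::
  "real \<Rightarrow> real \<Rightarrow> (real \<times> real \<Rightarrow> real) \<Rightarrow> nat \<Rightarrow> (nat \<Rightarrow> real) \<Rightarrow>
   (real \<Rightarrow> real) \<Rightarrow> (nat \<Rightarrow> real \<Rightarrow> real) \<Rightarrow> real \<Rightarrow> bool" where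
  "discrete_system a b f n \<alpha> y x t \<longleftrightarrow>
     (y has_real_derivative f (y t, \<Sum>i\<le>n. \<alpha> i * x i t)) (at t) \<and>
     (x 0 has_real_derivative y (t - a) - y (t - b)) (at t) \<and>
     (\<forall>i\<in>{1..n}. (x i has_real_derivative
        y (t - a) * a ^ i - y (t - b) * b ^ i + real i * x (i - 1) t) (at t))"

definition discrete_solution ::
  "real \<Rightarrow> real \<Rightarrow> (real \<times> real \<Rightarrow> real) \<Rightarrow> nat \<Rightarrow> (nat \<Rightarrow> real) \<Rightarrow> (real \<Rightarrow> real) \<Rightarrow> (nat \<Rightarrow> real) \<Rightarrow>
   (real \<Rightarrow> real) \<Rightarrow> (nat \<Rightarrow> real \<Rightarrow> real) \<Rightarrow> bool" where
  "discrete_solution a b f n \<alpha> \<phi> \<xi> y x \<longleftrightarrow>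
     continuous_on {-b..} y \<and> (\<forall>i\<le>n. continuous_on {0..} (x i)) \<and>
     C1_right_of_zero y \<and> (\<forall>i\<le>n. C1_right_of_zero (x i)) \<and>
     (\<forall>t>0. discrete_system a b f n \<alpha> y x t) \<and>
     (\<forall>t\<in>{-b..0}. y t = \<phi> t) \<and> (\<forall>i\<le>n. x i 0 = \<xi> i)"

end

theory Submission
  imports Defs
begin

text \<open>
  Integrating by parts against an antiderivative of \<open>y\<close> moves the dependence on \<open>t\<close> in
  \<open>\<integral> y (t - \<tau>) * \<tau> ^ i\<close> onto a \<open>C\<^sup>1\<close> function, so that one may differentiate under the integral.
  Hence the moments of \<open>y\<close> satisfy the equations for the \<open>x i\<close>. Conversely, these equations are
  triangular: by induction on \<open>i\<close>, \<open>x i\<close> and the \<open>i\<close>-th moment have the same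
  derivative and the same value at \<open>0\<close>, so they agree.
\<close>

section \<open>Derivatives of convolutions over a compact interval\<close>

lemma continuous_on_shift_mult:
  fixes y p :: "real \<Rightarrow> real"
  assumes "continuous_on UNIV y" "continuous_on UNIV p"
  shows "continuous_on S (\<lambda>\<tau>. y (s - \<tau>) * p \<tau>)"
  by (intro continuous_intros continuous_on_compose2[OF assms(1)]
      continuous_on_subset[OF assms(2)]) auto

lemma integrable_shift_mult:
  fixes y p :: "real \<Rightarrow> real"
  assumes "continuous_on UNIV y" "continuous_on UNIV p"
  shows "(\<lambda>\<tau>. y (s - \<tau>) * p \<tau>) integrable_on {a..b}"
  using continuous_on_shift_mult[OF assms] by (rule integrable_continuous_interval)

text \<open>Leibniz rule: the partial derivative in \<open>s\<close> of the integrand is jointly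
  continuous because \<open>Y\<close> has the continuous derivative \<open>y\<close>.\<close>

lemma convolution_has_real_derivative_C1:
  fixes Y y p :: "real \<Rightarrow> real"
  assumes Y: "\<And>u. (Y has_real_derivative y u) (at u)"
    and y: "continuous_on UNIV y" and p: "continuous_on UNIV p"
  shows "((\<lambda>s. integral {a..b} (\<lambda>\<tau>. Y (s - \<tau>) * p \<tau>)) has_real_derivative
    integral {a..b} (\<lambda>\<tau>. y (t - \<tau>) * p \<tau>)) (at t)"
proof -
  have cont_Y: "continuous_on UNIV Y"
    using Y by (meson DERIV_continuous_on)
  have "((\<lambda>s. integral (cbox a b) (\<lambda>\<tau>. Y (s - \<tau>) * p \<tau>)) has_real_derivative
    integral (cbox a b) (\<lambda>\<tau>. y (t - \<tau>) * p \<tau>)) (at t within UNIV)"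
  proof (rule leibniz_rule_field_derivative)
    show "((\<lambda>s. Y (s - \<tau>) * p \<tau>) has_real_derivative y (s - \<tau>) * p \<tau>) (at s within UNIV)" for s \<tau>
      by (auto intro!: derivative_eq_intros DERIV_chain2[OF Y])
    show "(\<lambda>\<tau>. Y (s - \<tau>) * p \<tau>) integrable_on cbox a b" for s
      using integrable_shift_mult[OF cont_Y p] by simp
    show "continuous_on (UNIV \<times> cbox a b) (\<lambda>(s, \<tau>). y (s - \<tau>) * p \<tau>)"
      unfolding case_prod_beta
      by (intro continuous_intros continuous_on_compose2[OF y] continuous_on_compose2[OF p]) auto
  qed auto
  then show ?thesis by simp
qed

text \<open>Since \<open>y\<close> is merely continuous, the Leibniz rule does not apply to the
  integrand as it stands. Integration by parts puts an antiderivative of \<open>y\<close> in its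
  place and leaves boundary terms at \<open>a\<close> and \<open>b\<close>, whose derivatives are
  the discrete delays.\<close>

lemma convolution_has_real_derivative:
  fixes y p p' :: "real \<Rightarrow> real"
  assumes y: "continuous_on UNIV y"
    and p: "\<And>\<tau>. (p has_real_derivative p' \<tau>) (at \<tau>)" and p': "continuous_on UNIV p'"
    and "a \<le> b"
  shows "((\<lambda>s. integral {a..b} (\<lambda>\<tau>. y (s - \<tau>) * p \<tau>)) has_real_derivative
    y (t - a) * p a - y (t - b) * p b + integral {a..b} (\<lambda>\<tau>. y (t - \<tau>) * p' \<tau>)) (at t)"
proof -
  have "isCont y u" for u
    using y by (simp add: continuous_on_eq_continuous_at)
  \<comment> \<open>The infinite endpoints give one antiderivative on the whole line, so every shift
    \<open>s - \<tau>\<close> is covered.\<close>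
  then obtain Y where Y: "\<And>u. (Y has_real_derivative y u) (at u)"
    using einterval_antiderivative[of "-\<infinity>" \<infinity> y]
    by (auto simp: has_real_derivative_iff_has_vector_derivative)
  have cont: "continuous_on UNIV Y" "continuous_on UNIV p"
    using Y p by (meson DERIV_continuous_on)+
  have by_parts: "integral {a..b} (\<lambda>\<tau>. y (s - \<tau>) * p \<tau>) =
    Y (s - a) * p a - Y (s - b) * p b + integral {a..b} (\<lambda>\<tau>. Y (s - \<tau>) * p' \<tau>)" for s
  proof -
    \<comment> \<open>Product rule in \<tau>: the reflection \<open>s - \<tau>\<close> makes
      \<open>- Y (s - \<tau>)\<close> the antiderivative of \<open>y (s - \<tau>)\<close>.\<close>
    have "((\<lambda>\<tau>. y (s - \<tau>) * p \<tau> - Y (s - \<tau>) * p' \<tau>) has_integral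
      (- Y (s - b) * p b - (- Y (s - a) * p a))) {a..b}"
    proof (rule fundamental_theorem_of_calculus[OF \<open>a \<le> b\<close>])
      fix \<tau> :: real
      have "((\<lambda>\<tau>. - Y (s - \<tau>) * p \<tau>) has_real_derivative
        y (s - \<tau>) * p \<tau> - Y (s - \<tau>) * p' \<tau>) (at \<tau>)"
        by (auto intro!: derivative_eq_intros DERIV_chain2[OF Y] p)
      then show "((\<lambda>\<tau>. - Y (s - \<tau>) * p \<tau>) has_vector_derivative
        y (s - \<tau>) * p \<tau> - Y (s - \<tau>) * p' \<tau>) (at \<tau> within {a..b})"
        using has_real_derivative_iff_has_vector_derivative has_vector_derivative_at_within by blast
    qed
    then have "integral {a..b} (\<lambda>\<tau>. y (s - \<tau>) * p \<tau> - Y (s - \<tau>) * p' \<tau>) =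
      Y (s - a) * p a - Y (s - b) * p b"
      by (simp add: integral_unique)
    moreover have "integral {a..b} (\<lambda>\<tau>. y (s - \<tau>) * p \<tau> - Y (s - \<tau>) * p' \<tau>) =
      integral {a..b} (\<lambda>\<tau>. y (s - \<tau>) * p \<tau>) - integral {a..b} (\<lambda>\<tau>. Y (s - \<tau>) * p' \<tau>)"
      by (intro integral_diff integrable_shift_mult y p' cont)
    ultimately show ?thesis by simp
  qed
  show ?thesis
    unfolding by_parts
    by (auto intro!: derivative_eq_intros DERIV_chain2[OF Y]
        convolution_has_real_derivative_C1[OF Y y p'])
qed

section \<open>Moments of the delayed function\<close>

text \<open>The arguments \<open>i\<close> and \<open>t\<close> come last so that
  \<open>delay_moment a b y\<close> is itself a candidate for the family \<open>x\<close>.\<close>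

definition delay_moment :: "real \<Rightarrow> real \<Rightarrow> (real \<Rightarrow> real) \<Rightarrow> nat \<Rightarrow> real \<Rightarrow> real" where
  "delay_moment a b y i t = integral {a..b} (\<lambda>\<tau>. y (t - \<tau>) * \<tau> ^ i)"

text \<open>The kernel is a power of \<tau>, whose derivative lowers the moment by one. For
  \<open>i = 0\<close> the factor \<open>real i\<close> annihilates the last term, so the truncated
  \<open>i - 1\<close> is harmless.\<close>

lemma delay_moment_has_real_derivative_UNIV:
  assumes "continuous_on UNIV y" "a \<le> b"
  shows "(delay_moment a b y i has_real_derivative
    y (t - a) * a ^ i - y (t - b) * b ^ i + real i * delay_moment a b y (i - 1) t) (at t)"
proof -
  have "((\<lambda>\<tau>. \<tau> ^ i) has_real_derivative real i * \<tau> ^ (i - 1)) (at \<tau>)" for \<tau> :: real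
    by (auto intro!: derivative_eq_intros)
  from convolution_has_real_derivative[OF assms(1) this _ assms(2)]
  have "((\<lambda>s. integral {a..b} (\<lambda>\<tau>. y (s - \<tau>) * \<tau> ^ i)) has_real_derivative
    y (t - a) * a ^ i - y (t - b) * b ^ i +
    integral {a..b} (\<lambda>\<tau>. y (t - \<tau>) * (real i * \<tau> ^ (i - 1)))) (at t)"
    by (simp add: continuous_intros)
  moreover have "integral {a..b} (\<lambda>\<tau>. y (t - \<tau>) * (real i * \<tau> ^ (i - 1))) =
    real i * delay_moment a b y (i - 1) t"
    by (simp add: delay_moment_def mult.left_commute)
  ultimately show ?thesis
    by (simp add: delay_moment_def[abs_def])
qed

text \<open>Constant continuation to the left makes the whole-line results available for a
  \<open>y\<close> that is continuous only on a half-line.\<close>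

lemma continuous_on_max_extension:
  fixes y :: "real \<Rightarrow> real"
  assumes "continuous_on {c..} y"
  shows "continuous_on UNIV (\<lambda>u. y (max u c))"
  by (rule continuous_on_compose2[OF assms]) (auto intro!: continuous_intros)

text \<open>For \<open>0 \<le> t\<close> and \<open>\<tau> \<le> b\<close> the argument
  \<open>t - \<tau>\<close> is at least \<open>- b\<close>, where the extension agrees with
  \<open>y\<close>.\<close>

lemma delay_moment_max_extension:
  assumes "0 \<le> t"
  shows "delay_moment a b (\<lambda>u. y (max u (- b))) i t = delay_moment a b y i t"
  unfolding delay_moment_def using assms by (intro integral_cong) (auto simp: max_absorb1)

lemma delay_moment_has_real_derivative:
  assumes y: "continuous_on {-b..} y" and "a \<le> b" and "0 < t"
  shows "(delay_moment a b y i has_real_derivative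
    y (t - a) * a ^ i - y (t - b) * b ^ i + real i * delay_moment a b y (i - 1) t) (at t)"
proof -
  have "(delay_moment a b (\<lambda>u. y (max u (- b))) i has_real_derivative
    y (t - a) * a ^ i - y (t - b) * b ^ i + real i * delay_moment a b y (i - 1) t) (at t)"
    using delay_moment_has_real_derivative_UNIV[OF continuous_on_max_extension[OF y] \<open>a \<le> b\<close>, of i t]
      assms by (simp add: delay_moment_max_extension max_absorb1)
  \<comment> \<open>The two moments are known to agree only for nonnegative times, so the derivative
    is transferred on the open set \<open>{0<..}\<close> around \<open>t\<close>.\<close>
  then show ?thesis
    by (rule has_field_derivative_transform_within_open[where S = "{0<..}"])
      (use \<open>0 < t\<close> in \<open>auto simp: delay_moment_max_extension\<close>)
qed

text \<open>The extended moment is differentiable at \<open>0\<close> too; this yields the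
  continuity at the left endpoint that ties a moment to its initial value.\<close>

lemma continuous_on_delay_moment:
  assumes y: "continuous_on {-b..} y" and "a \<le> b"
  shows "continuous_on {0..} (delay_moment a b y i)"
proof -
  have "continuous_on {0..} (delay_moment a b (\<lambda>u. y (max u (- b))) i)"
    using delay_moment_has_real_derivative_UNIV[OF continuous_on_max_extension[OF y] \<open>a \<le> b\<close>]
    by (meson continuous_at_imp_continuous_on DERIV_isCont)
  then show ?thesis
    by (rule continuous_on_eq) (simp add: delay_moment_max_extension)
qed

text \<open>Linearity of the integral identifies the second arguments of \<open>f\<close> in the two
  problems; both directions rest on it.\<close>

lemma sum_delay_moment:
  assumes y: "continuous_on {-b..} y" and "0 \<le> t"
    and g: "\<forall>\<tau>\<in>{a..b}. g \<tau> = (\<Sum>i\<le>n. \<alpha> i * \<tau> ^ i)"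
  shows "(\<Sum>i\<le>n. \<alpha> i * delay_moment a b y i t) = integral {a..b} (\<lambda>\<tau>. y (t - \<tau>) * g \<tau>)"
proof -
  have "continuous_on {a..b} (\<lambda>\<tau>. y (t - \<tau>) * \<tau> ^ i)" for i
    using \<open>0 \<le> t\<close> by (intro continuous_intros continuous_on_compose2[OF y]) auto
  then have int: "(\<lambda>\<tau>. y (t - \<tau>) * \<tau> ^ i) integrable_on {a..b}" for i
    by (rule integrable_continuous_interval)
  have "integral {a..b} (\<lambda>\<tau>. y (t - \<tau>) * g \<tau>) =
    integral {a..b} (\<lambda>\<tau>. \<Sum>i\<le>n. \<alpha> i * (y (t - \<tau>) * \<tau> ^ i))"
    by (rule integral_cong) (simp add: g sum_distrib_left mult_ac)
  also have "\<dots> = (\<Sum>i\<le>n. integral {a..b} (\<lambda>\<tau>. \<alpha> i * (y (t - \<tau>) * \<tau> ^ i)))"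
    by (rule integral_sum) (auto intro!: integrable_on_mult_right int)
  finally show ?thesis
    by (simp add: delay_moment_def)
qed

section \<open>Identifying the auxiliary variables with the moments\<close>

lemma eq_if_same_derivative_right_of_zero:
  fixes u v :: "real \<Rightarrow> real"
  assumes "continuous_on {0..} u" "continuous_on {0..} v" "u 0 = v 0"
    and u: "\<And>t. 0 < t \<Longrightarrow> (u has_real_derivative d t) (at t)"
    and v: "\<And>t. 0 < t \<Longrightarrow> (v has_real_derivative d t) (at t)"
    and "0 \<le> t"
  shows "u t = v t"
proof (cases "t = 0")
  case False
  have "u t - v t = u 0 - v 0"
  proof (rule DERIV_isconst_end[where f = "\<lambda>s. u s - v s"])
    show "0 < t" using \<open>0 \<le> t\<close> False by simp
    show "continuous_on {0..t} (\<lambda>s. u s - v s)"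
      by (intro continuous_intros assms(1,2)[THEN continuous_on_subset]) auto
    show "((\<lambda>s. u s - v s) has_real_derivative 0) (at s)" if "0 < s" "s < t" for s
      using DERIV_diff[OF u[OF that(1)] v[OF that(1)]] by simp
  qed
  then show ?thesis using \<open>u 0 = v 0\<close> by simp
qed (simp add: assms)

text \<open>Here \<open>y\<close> is given, so each \<open>x i\<close> is found by integrating a
  known function; uniqueness for the nonlinear equation of \<open>y\<close> does not enter.\<close>

lemma discrete_solution_eq_delay_moment:
  assumes sol: "discrete_solution a b f n \<alpha> \<phi> \<xi> y x"
    and init: "\<And>i. i \<le> n \<Longrightarrow> \<xi> i = delay_moment a b y i 0"
    and "a \<le> b" "i \<le> n" "0 \<le> t"
  shows "x i t = delay_moment a b y i t"
  using assms(4,5)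
\<comment> \<open>The time is generalised because the derivative of the next variable at each
  \<open>s\<close> involves \<open>x i s\<close>.\<close>
proof (induction i arbitrary: t)
  case 0
  have "continuous_on {-b..} y" using sol by (simp add: discrete_solution_def)
  show ?case
    by (rule eq_if_same_derivative_right_of_zero[where d = "\<lambda>t. y (t - a) - y (t - b)"])
      (use sol init 0 continuous_on_delay_moment[OF \<open>continuous_on {-b..} y\<close> \<open>a \<le> b\<close>]
         delay_moment_has_real_derivative[OF \<open>continuous_on {-b..} y\<close> \<open>a \<le> b\<close>, of _ 0] in
        \<open>auto simp: discrete_solution_def discrete_system_def\<close>)
next
  case (Suc i)
  have y: "continuous_on {-b..} y" using sol by (simp add: discrete_solution_def)
  have x_deriv: "(x (Suc i) has_real_derivative y (s - a) * a ^ Suc i - y (s - b) * b ^ Suc i +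
    real (Suc i) * delay_moment a b y i s) (at s)" if "0 < s" for s
  proof -
    have "(x (Suc i) has_real_derivative y (s - a) * a ^ Suc i - y (s - b) * b ^ Suc i +
      real (Suc i) * x (Suc i - 1) s) (at s)"
      using sol that \<open>Suc i \<le> n\<close> unfolding discrete_solution_def discrete_system_def
      by (metis atLeastAtMost_iff le_add1 plus_1_eq_Suc)
    then show ?thesis
      using Suc that by simp
  qed
  show ?case
  proof (rule eq_if_same_derivative_right_of_zero[OF _ _ _ x_deriv])
    show "continuous_on {0..} (x (Suc i))" "x (Suc i) 0 = delay_moment a b y (Suc i) 0"
      using sol init Suc.prems by (auto simp: discrete_solution_def)
    show "continuous_on {0..} (delay_moment a b y (Suc i))"
      using y \<open>a \<le> b\<close> by (rule continuous_on_delay_moment)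
    show "(delay_moment a b y (Suc i) has_real_derivative y (s - a) * a ^ Suc i -
      y (s - b) * b ^ Suc i + real (Suc i) * delay_moment a b y i s) (at s)" if "0 < s" for s
      using delay_moment_has_real_derivative[OF y \<open>a \<le> b\<close> that, of "Suc i"] by simp
  qed (use \<open>0 \<le> t\<close> in auto)
qed

theorem theorem2:
  fixes a b :: real
    and f :: "real \<times> real \<Rightarrow> real"
    and g :: "real \<Rightarrow> real"
    and n :: nat
    and \<alpha> :: "nat \<Rightarrow> real"
    and \<phi> :: "real \<Rightarrow> real"
  assumes "0 \<le> a" and "a < b"
    and "continuous_on UNIV f"
    and "weight_function a b g"
    and "\<forall>\<tau>\<in>{a..b}. g \<tau> = (\<Sum>i\<le>n. \<alpha> i * \<tau> ^ i)"
    and "\<alpha> n \<noteq> 0"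
    and "continuous_on {-b..0} \<phi>"
  shows
    "(\<forall>y. distributed_solution a b f g \<phi> y \<longrightarrow>
        (\<forall>t>0. discrete_system a b f n \<alpha> y
          (\<lambda>i s. integral {a..b} (\<lambda>\<tau>. y (s - \<tau>) * \<tau> ^ i)) t)) \<and>
     (\<forall>y x. discrete_solution a b f n \<alpha> \<phi>
          (\<lambda>i. integral {a..b} (\<lambda>\<tau>. \<phi> (- \<tau>) * \<tau> ^ i)) y x \<longrightarrow>
        distributed_solution a b f g \<phi> y)"
proof (intro conjI allI impI)
  fix y :: "real \<Rightarrow> real" and t :: real
  assume sol: "distributed_solution a b f g \<phi> y" and "0 < t"
  have y: "continuous_on {-b..} y" using sol by (simp add: distributed_solution_def)
  have "(y has_real_derivative f (y t, \<Sum>i\<le>n. \<alpha> i * delay_moment a b y i t)) (at t)"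
    using sol \<open>0 < t\<close> sum_delay_moment[OF y _ assms(5)]
    by (simp add: distributed_solution_def distributed_eq_def)
  then have "discrete_system a b f n \<alpha> y (delay_moment a b y) t"
    using delay_moment_has_real_derivative[OF y _ \<open>0 < t\<close>, of a] \<open>a < b\<close>
      \<comment> \<open>The instance at \<open>0\<close> simplifies to the separate equation of
        \<open>x 0\<close>.\<close>
      delay_moment_has_real_derivative[OF y _ \<open>0 < t\<close>, of a 0]
    by (simp add: discrete_system_def)
  then show "discrete_system a b f n \<alpha> y
    (\<lambda>i s. integral {a..b} (\<lambda>\<tau>. y (s - \<tau>) * \<tau> ^ i)) t"
    by (simp add: delay_moment_def[abs_def])
next
  fix y :: "real \<Rightarrow> real" and x :: "nat \<Rightarrow> real \<Rightarrow> real"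
  assume sol: "discrete_solution a b f n \<alpha> \<phi>
    (\<lambda>i. integral {a..b} (\<lambda>\<tau>. \<phi> (- \<tau>) * \<tau> ^ i)) y x"
  have y: "continuous_on {-b..} y" and hist: "\<forall>t\<in>{-b..0}. y t = \<phi> t"
    using sol by (auto simp: discrete_solution_def)
  \<comment> \<open>As \<open>0 \<le> a\<close>, the points \<open>- \<tau>\<close> lie in
    \<open>{-b..0}\<close>, where \<open>y\<close> is the history; hence the prescribed initial
    values are moments of \<open>y\<close> at time \<open>0\<close>.\<close>
  have "integral {a..b} (\<lambda>\<tau>. \<phi> (- \<tau>) * \<tau> ^ i) = delay_moment a b y i 0" for i
    unfolding delay_moment_def using \<open>0 \<le> a\<close> hist by (intro integral_cong) auto
  then have x: "x i t = delay_moment a b y i t" if "i \<le> n" "0 \<le> t" for i t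
    using discrete_solution_eq_delay_moment[OF sol] that \<open>a < b\<close> by simp
  have "distributed_eq a b f g y t" if "0 < t" for t
  proof -
    have "(\<Sum>i\<le>n. \<alpha> i * x i t) = integral {a..b} (\<lambda>\<tau>. y (t - \<tau>) * g \<tau>)"
      using sum_delay_moment[OF y _ assms(5), of t] x that by simp
    moreover have "(y has_real_derivative f (y t, \<Sum>i\<le>n. \<alpha> i * x i t)) (at t)"
      using sol that by (simp add: discrete_solution_def discrete_system_def)
    ultimately show ?thesis
      by (simp add: distributed_eq_def)
  qed
  \<comment> \<open>Continuity, regularity and history are common to both notions of solution; only
    the differential equation had to be converted.\<close>
  then show "distributed_solution a b f g \<phi> y"
    using sol by (simp add: distributed_solution_def discrete_solution_def)
qed

end
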